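(* For a metric group $G$ the following conditions are equivalent: (i) $G$ is NSS; (ii) $G$ does not contain an $f_\omega$-Cauchy productive sequence; (iii) $G$ does not contain an unconditionally $f_\omega$-Cauchy productive sequence.
   Context: All topological groups are Hausdorff; $\mathbb N=\{0,1,2,\dots\}$. A metric group is a metrizable topological group. A topological group is NSS if some neighbourhood of its identity contains no nontrivial subgroup. A sequence $\{x_n:n\in\mathbb N\}$ in a topological group $G$ is left Cauchy if for every neighbourhood $U$ of the identity there is $k\in\mathbb N$ with $x_l^{-1}x_m\in U$ for all $l,m\ge k$. Products are ordered: $\prod_{n=0}^m b_n=b_0b_1\cdots b_m$. A sequence $\{b_n:n\in\mathbb N\}$ in $G$ is Cauchy productive if $\{\prod_{n=0}^m b_n:m\in\mathbb N\}$ is left Cauchy. A sequence $\{a_n:n\in\mathbb N\}$ in $G$ is $f_\omega$-Cauchy productive if it is faithfully indexed ($a_n\ne a_m$ for $n\neq m$) and $\{a_n^{z(n)}:n\in\mathbb N\}$ is Cauchy productive for every function $z:\mathbb N\to\mathbb Z$. ($f_\omega$ is the constant function with value $\omega$.) It is unconditionally $f_\omega$-Cauchy productive if it is faithfully indexed and $\{a_{\varphi(n)}:n\in\mathbb N\}$ is $f_\omega$-Cauchy productive for every bijection $\varphi:\mathbb N\to\mathbb N$. *)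

theory Defs
  imports "HOL-Analysis.Analysis" "HOL-Algebra.Group"
begin

locale topological_group = group G for G (structure) +
  fixes T :: "'a topology"
  assumes topspace_eq: "topspace T = carrier G"
    and Hausdorff: "Hausdorff_space T"
    and continuous_mult: "continuous_map (prod_topology T T) T (\<lambda>(x, y). x \<otimes> y)"
    and continuous_inv: "continuous_map T T (\<lambda>x. inv\<^bsub>G\<^esub> x)"

locale metric_group = topological_group +
  assumes metrizable: "metrizable_space T"

text \<open>Neighbourhoods are not required to be open.\<close>

definition identity_nbhd :: "('a, 'b) monoid_scheme \<Rightarrow> 'a topology \<Rightarrow> 'a set \<Rightarrow> bool" where
  "identity_nbhd G T U \<longleftrightarrow> U \<subseteq> topspace T \<and> \<one>\<^bsub>G\<^esub> \<in> T interior_of U"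

definition NSS :: "('a, 'b) monoid_scheme \<Rightarrow> 'a topology \<Rightarrow> bool" where
  "NSS G T \<longleftrightarrow>
     (\<exists>U. identity_nbhd G T U \<and> (\<forall>H. subgroup H G \<and> H \<subseteq> U \<longrightarrow> H = {\<one>\<^bsub>G\<^esub>}))"

definition left_Cauchy :: "('a, 'b) monoid_scheme \<Rightarrow> 'a topology \<Rightarrow> (nat \<Rightarrow> 'a) \<Rightarrow> bool" where
  "left_Cauchy G T x \<longleftrightarrow>
     (\<forall>U. identity_nbhd G T U \<longrightarrow>
       (\<exists>k. \<forall>l\<ge>k. \<forall>m\<ge>k. inv\<^bsub>G\<^esub> (x l) \<otimes>\<^bsub>G\<^esub> x m \<in> U))"

text \<open>The group need not be commutative, so \<open>finprod\<close> does not apply: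
  \<open>ordered_prod G b m\<close> is the product of \<open>b 0, \<dots>, b m\<close> in this order, both ends included.\<close>

primrec ordered_prod :: "('a, 'b) monoid_scheme \<Rightarrow> (nat \<Rightarrow> 'a) \<Rightarrow> nat \<Rightarrow> 'a" where
  "ordered_prod G b 0 = b 0"
| "ordered_prod G b (Suc m) = ordered_prod G b m \<otimes>\<^bsub>G\<^esub> b (Suc m)"

definition Cauchy_productive :: "('a, 'b) monoid_scheme \<Rightarrow> 'a topology \<Rightarrow> (nat \<Rightarrow> 'a) \<Rightarrow> bool" where
  "Cauchy_productive G T b \<longleftrightarrow> left_Cauchy G T (ordered_prod G b)"

text \<open>Sequences in \<open>G\<close> are functions into the ambient type, hence the range conditions below.\<close>

definition f_omega_Cauchy_productive ::
    "('a, 'b) monoid_scheme \<Rightarrow> 'a topology \<Rightarrow> (nat \<Rightarrow> 'a) \<Rightarrow> bool" where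
  "f_omega_Cauchy_productive G T a \<longleftrightarrow>
     range a \<subseteq> carrier G \<and> inj a \<and>
     (\<forall>z :: nat \<Rightarrow> int. Cauchy_productive G T (\<lambda>n. a n [^]\<^bsub>G\<^esub> z n))"

definition unconditionally_f_omega_Cauchy_productive ::
    "('a, 'b) monoid_scheme \<Rightarrow> 'a topology \<Rightarrow> (nat \<Rightarrow> 'a) \<Rightarrow> bool" where
  "unconditionally_f_omega_Cauchy_productive G T a \<longleftrightarrow>
     range a \<subseteq> carrier G \<and> inj a \<and>
     (\<forall>\<phi> :: nat \<Rightarrow> nat. bij \<phi> \<longrightarrow> f_omega_Cauchy_productive G T (\<lambda>n. a (\<phi> n)))"

end

theory Submission
  imports Defs
begin

text \<open>An NSS group has a neighbourhood \<open>U\<close> of the identity such that every nontrivial element has a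
  power outside \<open>U\<close>. Choosing such powers as exponents, the factors of the product do not tend to the
  identity, so no sequence is \<open>f\<^sub>\<omega>\<close>-Cauchy productive.
  Conversely, if \<open>G\<close> is not NSS, choose a neighbourhood base \<open>V\<^sub>n\<close> at the identity with
  \<open>V\<^sub>n\<^sub>+\<^sub>1 V\<^sub>n\<^sub>+\<^sub>1 V\<^sub>n\<^sub>+\<^sub>1 \<subseteq> V\<^sub>n\<close>, and nontrivial \<open>a\<^sub>n\<close>, all of whose powers lie in \<open>V\<^sub>n\<close>. A product, in
  any order, of elements of distinct \<open>V\<^sub>i\<close> with \<open>i > k\<close> lies in \<open>V\<^sub>k\<close>: split it at the factor of
  least index \<open>i\<close>; inductively the two outer parts lie in \<open>V\<^sub>i\<close>. Hence the sequence \<open>a\<close> is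
  unconditionally \<open>f\<^sub>\<omega>\<close>-Cauchy productive.\<close>

section \<open>Finite products and integer powers in a group\<close>

lemma (in monoid) foldr_mult_closed:
  assumes "set xs \<subseteq> carrier G"
  shows "foldr (\<otimes>) xs \<one> \<in> carrier G"
  using assms by (induction xs) auto

lemma (in monoid) foldr_mult_append:
  assumes "set xs \<subseteq> carrier G" "set ys \<subseteq> carrier G"
  shows "foldr (\<otimes>) (xs @ ys) \<one> = foldr (\<otimes>) xs \<one> \<otimes> foldr (\<otimes>) ys \<one>"
  using assms by (induction xs) (auto simp: foldr_mult_closed m_assoc)

lemma (in group) range_int_pow_subgroup:
  assumes "x \<in> carrier G"
  shows "subgroup (range (\<lambda>i::int. x [^] i)) G"
proof (rule subgroupI)
  show "range (\<lambda>i::int. x [^] i) \<subseteq> carrier G"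
    using assms by auto
  show "inv y \<in> range (\<lambda>i::int. x [^] i)" if "y \<in> range (\<lambda>i::int. x [^] i)" for y
    using that assms by (auto simp flip: int_pow_neg)
  show "y \<otimes> w \<in> range (\<lambda>i::int. x [^] i)"
    if "y \<in> range (\<lambda>i::int. x [^] i)" "w \<in> range (\<lambda>i::int. x [^] i)" for y w
    using that assms by (auto simp flip: int_pow_mult)
qed auto

lemma (in group) subgroup_closed_int_pow:
  assumes "subgroup H G" "x \<in> H"
  shows "x [^] (i::int) \<in> H"
proof -
  interpret H: subgroup H G by fact
  interpret HG: group "G\<lparr>carrier := H\<rparr>" by (rule H.subgroup_is_group[OF is_group])
  show ?thesis
    using HG.int_pow_closed[of x i] int_pow_consistent[OF assms] assms by simp
qed

lemma (in group) ordered_prod_closed: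
  assumes "range b \<subseteq> carrier G"
  shows "ordered_prod G b m \<in> carrier G"
  using assms by (induction m) auto

text \<open>The factors with index up to \<open>l\<close> cancel. The left Cauchy condition thereby
  becomes a statement about products over lists, which can be split at any entry.\<close>

lemma (in group) ordered_prod_quotient:
  assumes "range b \<subseteq> carrier G" "l \<le> m"
  shows "inv (ordered_prod G b l) \<otimes> ordered_prod G b m = foldr (\<otimes>) (map b [Suc l..<Suc m]) \<one>"
  using assms(2)
proof (induction m rule: dec_induct)
  case base
  then show ?case using assms(1) by (simp add: ordered_prod_closed)
next
  case (step m)
  have b: "b i \<in> carrier G" for i using assms(1) by auto
  have "inv (ordered_prod G b l) \<otimes> ordered_prod G b (Suc m)
      = foldr (\<otimes>) (map b [Suc l..<Suc m]) \<one> \<otimes> b (Suc m)"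
    using step.IH b assms(1) by (simp add: ordered_prod_closed flip: m_assoc)
  also have "\<dots> = foldr (\<otimes>) (map b [Suc l..<Suc m] @ [b (Suc m)]) \<one>"
    using assms(1) b by (subst foldr_mult_append) auto
  also have "map b [Suc l..<Suc m] @ [b (Suc m)] = map b [Suc l..<Suc (Suc m)]"
    using step.hyps by simp
  finally show ?case .
qed

section \<open>Products of elements taken from a shrinking sequence of sets\<close>

lemma (in monoid) cube_antimono:
  fixes V :: "nat \<Rightarrow> 'a set"
  assumes V: "\<And>n. \<one> \<in> V n" "\<And>n. V n \<subseteq> carrier G"
    and cube: "\<And>n x y w. \<lbrakk>x \<in> V (Suc n); y \<in> V (Suc n); w \<in> V (Suc n)\<rbrakk> \<Longrightarrow> x \<otimes> (y \<otimes> w) \<in> V n"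
  shows "antimono V"
proof -
  \<comment> \<open>Two of the three factors in \<open>cube\<close> are taken to be the
    identity.\<close>
  have "x \<in> V n" if "x \<in> V (Suc n)" for x n
    using cube[OF that V(1) V(1)] that V(2)[of "Suc n"] by auto
  then show ?thesis
    by (auto simp: antimono_iff_le_Suc)
qed

text \<open>A list of indices is used because a rearrangement presents them in no particular order.
  The induction keeps \<open>k\<close> arbitrary, since the outer parts are treated with the least
  index \<open>j\<close> in place of \<open>k\<close>.\<close>

lemma (in monoid) rearranged_product_in_nbhd:
  fixes V :: "nat \<Rightarrow> 'a set"
  assumes V: "\<And>n. \<one> \<in> V n" "\<And>n. V n \<subseteq> carrier G"
    and cube: "\<And>n x y w. \<lbrakk>x \<in> V (Suc n); y \<in> V (Suc n); w \<in> V (Suc n)\<rbrakk> \<Longrightarrow> x \<otimes> (y \<otimes> w) \<in> V n"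
    and f: "\<And>i. f i \<in> V i"
    and js: "distinct js" "\<forall>j\<in>set js. k < j"
  shows "foldr (\<otimes>) (map f js) \<one> \<in> V k"
  using js
proof (induction js arbitrary: k rule: length_induct)
  case (1 js)
  have "antimono V"
    by (rule cube_antimono[OF V cube])
  have carr: "set (map f xs) \<subseteq> carrier G" for xs
    using f V(2) by auto
  show ?case
  proof (cases "js = []")
    case False
    define j where "j = Min (set js)"
    have j: "j \<in> set js" "\<And>i. i \<in> set js \<Longrightarrow> j \<le> i"
      using False by (auto simp: j_def)
    then obtain xs ys where split: "js = xs @ j # ys"
      by (meson split_list)
    \<comment> \<open>Minimality gives \<le>; distinctness of \<open>js\<close> makes it
      strict.\<close>
    have "\<forall>i\<in>set xs. j < i" "\<forall>i\<in>set ys. j < i"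
      using j "1.prems"(1) by (auto simp: split order.strict_iff_order)
    then have "foldr (\<otimes>) (map f xs) \<one> \<in> V j" "foldr (\<otimes>) (map f ys) \<one> \<in> V j"
      using "1.IH" "1.prems"(1) by (auto simp: split)
    moreover have "k < j" using "1.prems"(2) j(1) by blast
    \<comment> \<open>The outer parts and \<open>f j\<close> all lie in \<open>V (Suc i)\<close>, so
      \<open>cube\<close> puts their product into \<open>V i\<close>, a subset of
      \<open>V k\<close>.\<close>
    then obtain i where "j = Suc i" "k \<le> i"
      by (metis less_Suc_eq_le less_imp_Suc_add le_add1)
    ultimately have "foldr (\<otimes>) (map f xs) \<one> \<otimes> (f j \<otimes> foldr (\<otimes>) (map f ys) \<one>) \<in> V k"
      using cube f[of j] antimonoD[OF \<open>antimono V\<close> \<open>k \<le> i\<close>] by auto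
    also have "foldr (\<otimes>) (map f xs) \<one> \<otimes> (f j \<otimes> foldr (\<otimes>) (map f ys) \<one>)
        = foldr (\<otimes>) (map f js) \<one>"
      using foldr_mult_append[of "map f xs" "map f (j # ys)"] carr[of xs] carr[of "j # ys"] by (simp add: split)
    finally show ?thesis .
  qed (use V in simp)
qed

section \<open>Neighbourhoods of the identity\<close>

context topological_group
begin

lemma openin_identity_nbhd:
  assumes "openin T U" "\<one> \<in> U"
  shows "identity_nbhd G T U"
  using assms by (simp add: identity_nbhd_def interior_of_openin openin_subset)

text \<open>The left Cauchy condition also concerns \<open>l > m\<close>, where the quotient is the
  inverse of the one with \<open>l\<close> and \<open>m\<close> exchanged; membership in
  \<open>W\<close> settles both cases.\<close>

lemma identity_nbhd_inv:
  assumes "identity_nbhd G T U"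
  obtains W where "openin T W" "\<one> \<in> W" "W \<subseteq> U" "\<And>x. x \<in> W \<Longrightarrow> inv x \<in> U"
proof
  let ?I = "T interior_of U"
  let ?W = "?I \<inter> {x \<in> topspace T. inv x \<in> ?I}"
  show "openin T ?W"
    by (intro openin_Int openin_interior_of openin_continuous_map_preimage[OF continuous_inv])
  show "\<one> \<in> ?W"
    using assms by (simp add: identity_nbhd_def topspace_eq)
  show "?W \<subseteq> U"
    using interior_of_subset[of T U] by blast
  show "inv x \<in> U" if "x \<in> ?W" for x
    using that interior_of_subset[of T U] by blast
qed

text \<open>Continuity of multiplication at the pair of identities is used twice: first for
  \<open>U\<close>, giving \<open>A\<close>, then for \<open>A\<close>, giving \<open>B\<close>. In
  the intersection, \<open>x\<close> and \<open>y \<otimes> w\<close> both lie in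
  \<open>A\<close>.\<close>

lemma open_cube_root:
  assumes "openin T U" "\<one> \<in> U"
  obtains W where "openin T W" "\<one> \<in> W"
    "\<And>x y w. \<lbrakk>x \<in> W; y \<in> W; w \<in> W\<rbrakk> \<Longrightarrow> x \<otimes> (y \<otimes> w) \<in> U"
proof -
  have square: "\<exists>W. openin T W \<and> \<one> \<in> W \<and> (\<forall>x\<in>W. \<forall>y\<in>W. x \<otimes> y \<in> U)"
    if U: "openin T U" "\<one> \<in> U" for U
  proof -
    let ?P = "{p \<in> topspace (prod_topology T T). (case p of (x, y) \<Rightarrow> x \<otimes> y) \<in> U}"
    have "openin (prod_topology T T) ?P"
      by (rule openin_continuous_map_preimage[OF continuous_mult U(1)])
    moreover have "(\<one>, \<one>) \<in> ?P"
      using U by (simp add: topspace_eq)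
    ultimately obtain A B where "openin T A" "openin T B" "\<one> \<in> A" "\<one> \<in> B" "A \<times> B \<subseteq> ?P"
      unfolding openin_prod_topology_alt by meson
    then show ?thesis by (intro exI[of _ "A \<inter> B"]) auto
  qed
  obtain A where A: "openin T A" "\<one> \<in> A" "\<And>x y. \<lbrakk>x \<in> A; y \<in> A\<rbrakk> \<Longrightarrow> x \<otimes> y \<in> U"
    using square[OF assms] by blast
  obtain B where B: "openin T B" "\<one> \<in> B" "\<And>x y. \<lbrakk>x \<in> B; y \<in> B\<rbrakk> \<Longrightarrow> x \<otimes> y \<in> A"
    using square[OF A(1,2)] by blast
  show ?thesis
    by (rule that[of "A \<inter> B"]) (use A B in auto)
qed

section \<open>NSS excludes Cauchy productive sequences\<close>

lemma NSS_imp_not_f_omega_Cauchy_productive: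
  assumes "NSS G T"
  shows "\<not> f_omega_Cauchy_productive G T a"
proof
  assume a: "f_omega_Cauchy_productive G T a"
  then have carr: "a n \<in> carrier G" for n
    by (auto simp: f_omega_Cauchy_productive_def)
  obtain U where U: "identity_nbhd G T U" "\<And>H. \<lbrakk>subgroup H G; H \<subseteq> U\<rbrakk> \<Longrightarrow> H = {\<one>}"
    using assms by (auto simp: NSS_def)
  have "\<exists>i::int. a n [^] i \<notin> U" if "a n \<noteq> \<one>" for n
  proof (rule ccontr)
    assume "\<nexists>i::int. a n [^] i \<notin> U"
    then have "range (\<lambda>i::int. a n [^] i) = {\<one>}"
      using U(2)[OF range_int_pow_subgroup[OF carr]] by blast
    moreover have "a n = a n [^] (1::int)"
      using carr by simp
    ultimately show False
      using that by (metis rangeI singletonD)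
  qed
  then obtain z :: "nat \<Rightarrow> int" where z: "\<And>n. a n \<noteq> \<one> \<Longrightarrow> a n [^] z n \<notin> U"
    by metis
  let ?b = "\<lambda>n. a n [^] z n"
  have "Cauchy_productive G T ?b"
    using a by (auto simp: f_omega_Cauchy_productive_def)
  then obtain k where k: "\<And>l m. \<lbrakk>k \<le> l; k \<le> m\<rbrakk> \<Longrightarrow>
      inv (ordered_prod G ?b l) \<otimes> ordered_prod G ?b m \<in> U"
    using U(1) unfolding Cauchy_productive_def left_Cauchy_def by meson
  \<comment> \<open>The quotient of two consecutive products is a single factor. Beyond
    \<open>k\<close> it lies in \<open>U\<close>, which the choice of \<open>z\<close> allows only
    for the identity. Injectivity of \<open>a\<close> permits this at one index at most.\<close>
  have "a (Suc n) = \<one>" if "k \<le> n" for n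
  proof -
    have "inv (ordered_prod G ?b n) \<otimes> ordered_prod G ?b (Suc n) = a (Suc n) [^] z (Suc n)"
      using carr by (subst ordered_prod_quotient) auto
    then show ?thesis
      using k[of n "Suc n"] z[of "Suc n"] that by auto
  qed
  then have "a (Suc k) = a (Suc (Suc k))" by simp
  then show False
    using a by (auto simp: f_omega_Cauchy_productive_def dest: injD)
qed

lemma unconditionally_imp_f_omega_Cauchy_productive:
  assumes "unconditionally_f_omega_Cauchy_productive G T a"
  shows "f_omega_Cauchy_productive G T a"
proof -
  have "f_omega_Cauchy_productive G T (\<lambda>n. a (id n))"
    using assms bij_id unfolding unconditionally_f_omega_Cauchy_productive_def by blast
  then show ?thesis by simp
qed

section \<open>Rearranged sequences are Cauchy productive\<close>

lemma Cauchy_productive_rearrangement: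
  fixes V :: "nat \<Rightarrow> 'a set" and \<phi> :: "nat \<Rightarrow> nat"
  assumes V: "\<And>n. \<one> \<in> V n" "\<And>n. V n \<subseteq> carrier G"
    and base: "\<And>U. \<lbrakk>openin T U; \<one> \<in> U\<rbrakk> \<Longrightarrow> \<exists>n. V n \<subseteq> U"
    and cube: "\<And>n x y w. \<lbrakk>x \<in> V (Suc n); y \<in> V (Suc n); w \<in> V (Suc n)\<rbrakk> \<Longrightarrow> x \<otimes> (y \<otimes> w) \<in> V n"
    and f: "\<And>i. f i \<in> V i" and \<phi>: "inj \<phi>"
  shows "Cauchy_productive G T (\<lambda>n. f (\<phi> n))"
  unfolding Cauchy_productive_def left_Cauchy_def
proof (intro allI impI)
  fix U assume "identity_nbhd G T U"
  then obtain W where W: "openin T W" "\<one> \<in> W" "W \<subseteq> U" "\<And>x. x \<in> W \<Longrightarrow> inv x \<in> U"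
    using identity_nbhd_inv by metis
  obtain k where k: "V k \<subseteq> W"
    using base W by blast
  \<comment> \<open>By injectivity, only finitely many positions carry an index up to
    \<open>k\<close>; past the last of them, the product lemma for \<open>V k\<close>
    applies.\<close>
  have "finite (\<phi> -` {..k})"
    using \<phi> by (simp add: finite_vimageI)
  then obtain N where N: "\<And>n. \<phi> n \<le> k \<Longrightarrow> n \<le> N"
    unfolding finite_nat_set_iff_bounded_le by auto
  let ?b = "\<lambda>n. f (\<phi> n)"
  let ?p = "ordered_prod G ?b"
  have b: "range ?b \<subseteq> carrier G"
    using f V(2) by auto
  have quot: "inv (?p l) \<otimes> ?p m \<in> W" if "N \<le> l" "l \<le> m" for l m
  proof -
    have "inv (?p l) \<otimes> ?p m = foldr (\<otimes>) (map f (map \<phi> [Suc l..<Suc m])) \<one>"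
      using ordered_prod_quotient[OF b that(2)] by (simp add: comp_def del: upt_Suc)
    also have "\<dots> \<in> V k"
    proof (rule rearranged_product_in_nbhd[OF V cube f])
      show "distinct (map \<phi> [Suc l..<Suc m])"
        using \<phi> by (simp add: distinct_map inj_on_def inj_def del: upt_Suc)
      show "\<forall>j\<in>set (map \<phi> [Suc l..<Suc m]). k < j"
        using N that by (force simp: not_le[symmetric] simp del: upt_Suc)
    qed
    finally show ?thesis using k by blast
  qed
  show "\<exists>k. \<forall>l\<ge>k. \<forall>m\<ge>k. inv (?p l) \<otimes> ?p m \<in> U"
  proof (intro exI allI impI)
    fix l m assume lm: "N \<le> l" "N \<le> m"
    show "inv (?p l) \<otimes> ?p m \<in> U"
    proof (cases "l \<le> m")
      case True
      then show ?thesis using quot lm W(3) by blast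
    next
      case False
      then have "inv (inv (?p m) \<otimes> ?p l) \<in> U"
        using quot[of m l] lm W(4) by simp
      then show ?thesis
        using ordered_prod_closed[OF b] by (simp add: inv_mult_group)
    qed
  qed
qed

end

section \<open>Construction of the sequence in a metric group that is not NSS\<close>

lemma (in metric_group) identity_base:
  obtains B where "\<And>n::nat. openin T (B n)" "\<And>n. \<one> \<in> B n"
    "\<And>U. \<lbrakk>openin T U; \<one> \<in> U\<rbrakk> \<Longrightarrow> \<exists>n. B n \<subseteq> U"
proof -
  \<comment> \<open>Metrizability enters through first countability.\<close>
  have "first_countable T"
    using metrizable by (rule metrizable_imp_first_countable)
  moreover have "\<one> \<in> topspace T"
    by (simp add: topspace_eq)
  ultimately obtain \<B> where \<B>: "countable \<B>" "\<And>V. V \<in> \<B> \<Longrightarrow> openin T V"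
    "\<And>U. \<lbrakk>openin T U; \<one> \<in> U\<rbrakk> \<Longrightarrow> \<exists>V\<in>\<B>. \<one> \<in> V \<and> V \<subseteq> U"
    unfolding first_countable_def by metis
  let ?\<B> = "{V \<in> \<B>. \<one> \<in> V}"
  have "?\<B> \<noteq> {}"
    using \<B>(3)[OF openin_topspace] topspace_eq by auto
  moreover have "countable ?\<B>"
    using \<B>(1) by (rule countable_subset[rotated]) auto
  ultimately have "range (from_nat_into ?\<B>) = ?\<B>"
    by (rule range_from_nat_into)
  then have mem: "from_nat_into ?\<B> n \<in> ?\<B>"
    and ex: "\<And>V. V \<in> ?\<B> \<Longrightarrow> \<exists>n. V = from_nat_into ?\<B> n" for n
    by auto
  show ?thesis
  proof
    show "openin T (from_nat_into ?\<B> n)" "\<one> \<in> from_nat_into ?\<B> n" for n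
      using mem[of n] \<B>(2) by auto
    show "\<exists>n. from_nat_into ?\<B> n \<subseteq> U" if U: "openin T U" "\<one> \<in> U" for U
    proof -
      obtain V where "V \<in> ?\<B>" "V \<subseteq> U"
        using \<B>(3)[OF U] by blast
      then show ?thesis using ex[of V] by metis
    qed
  qed
qed

lemma (in metric_group) not_NSS_imp_unconditionally_f_omega_Cauchy_productive:
  assumes "\<not> NSS G T"
  shows "\<exists>a. unconditionally_f_omega_Cauchy_productive G T a"
proof -
  obtain B where B: "\<And>n::nat. openin T (B n)" "\<And>n. \<one> \<in> B n"
    "\<And>U. \<lbrakk>openin T U; \<one> \<in> U\<rbrakk> \<Longrightarrow> \<exists>n. B n \<subseteq> U"
    using identity_base by blast
  let ?good = "\<lambda>V x. openin T V \<and> \<one> \<in> V \<and> x \<noteq> \<one> \<and> (\<forall>i::int. x [^] i \<in> V) \<and> x \<in> V"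
  have small: "\<exists>x. ?good V x" if V: "openin T V" "\<one> \<in> V" for V
  proof -
    obtain H where H: "subgroup H G" "H \<subseteq> V" "H \<noteq> {\<one>}"
      using assms openin_identity_nbhd[OF V] by (auto simp: NSS_def)
    then obtain x where "x \<in> H" "x \<noteq> \<one>"
      using subgroup.one_closed by blast
    then show ?thesis
      using H V subgroup_closed_int_pow by blast
  qed
  \<comment> \<open>Neighbourhoods and elements are chosen together: \<open>x \<notin> V'\<close>
    will make the elements distinct, and \<open>V' \<subseteq> B n\<close> makes the neighbourhoods
    a base at the identity.\<close>
  have "\<exists>s. \<forall>n. (case s n of (V, x) \<Rightarrow> ?good V x) \<and>
      (case (s n, s (Suc n)) of ((V, x), (V', y)) \<Rightarrow>
        V' \<subseteq> B n \<and> x \<notin> V' \<and> (\<forall>u\<in>V'. \<forall>v\<in>V'. \<forall>w\<in>V'. u \<otimes> (v \<otimes> w) \<in> V))"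
  proof (intro dependent_nat_choice)
    show "\<exists>s. case s of (V, x) \<Rightarrow> ?good V x"
      using small[OF openin_topspace] by (auto simp: topspace_eq)
  next
    fix s :: "'a set \<times> 'a" and n
    assume "case s of (V, x) \<Rightarrow> ?good V x"
    then obtain V x where s: "s = (V, x)" and V: "openin T V" "\<one> \<in> V" "x \<noteq> \<one>" "x \<in> V"
      by auto
    obtain W where W: "openin T W" "\<one> \<in> W"
      "\<And>u v w. \<lbrakk>u \<in> W; v \<in> W; w \<in> W\<rbrakk> \<Longrightarrow> u \<otimes> (v \<otimes> w) \<in> V"
      using open_cube_root V by metis
    \<comment> \<open>Removing \<open>x\<close> keeps the set open, as points are closed in a
      Hausdorff space, and keeps the identity in it, as \<open>x \<noteq> \<one>\<close>.\<close>
    let ?V' = "W \<inter> B n - {x}"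
    have "closedin T {x}"
      using V openin_subset by (intro closedin_Hausdorff_singleton Hausdorff) blast
    then have "openin T ?V'" "\<one> \<in> ?V'"
      using W B V by (auto intro!: openin_diff)
    then obtain y where "?good ?V' y"
      using small by blast
    then show "\<exists>s'. (case s' of (V, x) \<Rightarrow> ?good V x) \<and>
        (case (s, s') of ((V, x), (V', y)) \<Rightarrow>
          V' \<subseteq> B n \<and> x \<notin> V' \<and> (\<forall>u\<in>V'. \<forall>v\<in>V'. \<forall>w\<in>V'. u \<otimes> (v \<otimes> w) \<in> V))"
      using W(3) by (intro exI[of _ "(?V', y)"]) (auto simp: s)
  qed
  then obtain s where all: "\<forall>n. (case s n of (V, x) \<Rightarrow> ?good V x) \<and>
      (case (s n, s (Suc n)) of ((V, x), (V', y)) \<Rightarrow>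
        V' \<subseteq> B n \<and> x \<notin> V' \<and> (\<forall>u\<in>V'. \<forall>v\<in>V'. \<forall>w\<in>V'. u \<otimes> (v \<otimes> w) \<in> V))" ..
  have s: "?good (fst (s n)) (snd (s n))"
    "fst (s (Suc n)) \<subseteq> B n" "snd (s n) \<notin> fst (s (Suc n))"
    "\<lbrakk>u \<in> fst (s (Suc n)); v \<in> fst (s (Suc n)); w \<in> fst (s (Suc n))\<rbrakk> \<Longrightarrow>
      u \<otimes> (v \<otimes> w) \<in> fst (s n)" for n u v w
    using all[rule_format, of n] by (simp_all add: case_prod_beta)
  define V a where "V n = fst (s n)" and "a n = snd (s n)" for n
  have V: "\<one> \<in> V n" "V n \<subseteq> carrier G" for n
    using s(1)[of n] openin_subset[of T "V n"] by (auto simp: V_def topspace_eq)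
  have base: "\<exists>n. V n \<subseteq> U" if "openin T U" "\<one> \<in> U" for U
    using B(3)[OF that] s(2) unfolding V_def by (meson subset_trans)
  have cube: "\<And>n u v w. \<lbrakk>u \<in> V (Suc n); v \<in> V (Suc n); w \<in> V (Suc n)\<rbrakk> \<Longrightarrow> u \<otimes> (v \<otimes> w) \<in> V n"
    using s(4) by (simp add: V_def)
  have pow: "a n [^] i \<in> V n" and a: "a n \<in> V n" "a n \<notin> V (Suc n)" for n and i :: int
    using s(1,3) by (auto simp: V_def a_def)
  have "antimono V"
    by (rule cube_antimono[OF V cube])
  \<comment> \<open>\<open>a n\<close> lies in \<open>V n\<close>, hence in
    \<open>V (Suc m)\<close>, which omits \<open>a m\<close>.\<close>
  have "a m \<noteq> a n" if "m < n" for m n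
    using a(1)[of n] a(2)[of m] antimonoD[OF \<open>antimono V\<close>, of "Suc m" n] that by auto
  then have "inj a"
    by (metis injI linorder_neqE_nat)
  have carr: "range a \<subseteq> carrier G"
    using a V(2) by auto
  have "f_omega_Cauchy_productive G T (\<lambda>n. a (\<phi> n))" if "bij \<phi>" for \<phi>
    unfolding f_omega_Cauchy_productive_def
  proof (intro conjI allI)
    show "range (\<lambda>n. a (\<phi> n)) \<subseteq> carrier G"
      using carr by auto
    show "inj (\<lambda>n. a (\<phi> n))"
      using \<open>inj a\<close> bij_is_inj[OF that] by (auto simp: inj_def)
    fix z :: "nat \<Rightarrow> int"
    \<comment> \<open>The exponents \<open>z\<close> are attached to positions, but the
      rearrangement lemma needs a family over the original indices; \<open>the_inv \<phi>\<close>
      translates. Any exponent is admissible, since all powers of \<open>a i\<close> lie in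
      \<open>V i\<close>.\<close>
    have "Cauchy_productive G T (\<lambda>n. (\<lambda>i. a i [^] z (the_inv \<phi> i)) (\<phi> n))"
      by (rule Cauchy_productive_rearrangement[OF V base cube pow bij_is_inj[OF that]])
    then show "Cauchy_productive G T (\<lambda>n. a (\<phi> n) [^] z n)"
      by (simp add: the_inv_f_f bij_is_inj[OF that])
  qed
  then show ?thesis
    using \<open>inj a\<close> carr by (auto simp: unconditionally_f_omega_Cauchy_productive_def)
qed

theorem theorem5p5:
  fixes G :: "('a, 'b) monoid_scheme" and T :: "'a topology"
  assumes "metric_group G T"
  shows "(NSS G T \<longleftrightarrow> \<not> (\<exists>a. f_omega_Cauchy_productive G T a)) \<and>
         (NSS G T \<longleftrightarrow> \<not> (\<exists>a. unconditionally_f_omega_Cauchy_productive G T a))"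
proof -
  interpret metric_group G T by fact
  show ?thesis
    using NSS_imp_not_f_omega_Cauchy_productive unconditionally_imp_f_omega_Cauchy_productive
      not_NSS_imp_unconditionally_f_omega_Cauchy_productive
    by blast
qed

end
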